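(* Let $f\colon A \to B$ be a surjective morphism of racks (or of quandles). The following conditions are equivalent: (1) $f$ is a covering; (2) the group $\mathrm{K}_{\vec f}\leq \mathrm{Pth}(A)$ of $\vec f$-symmetric paths acts trivially on $A$ (as a subgroup of $\mathrm{Pth}(A)$), i.e. $x\cdot g = x$ for all $x\in A$ and all $g\in \mathrm{K}_{\vec f}$; (3) $\mathrm{Ker}(\vec f)$ acts trivially on $A$ (as a subgroup of $\mathrm{Pth}(A)$); (4) $\mathrm{Ker}(\vec f)$ is a subgroup of $\mathrm{Ker}(s)$, where $s\colon \mathrm{Pth}(A)\to \mathrm{Inn}(A)$ is the canonical quotient homomorphism.
   Context: A rack is a set $X$ with two binary operations $\triangleleft,\triangleleft^{-1}$ such that $(x\triangleleft y)\triangleleft^{-1}y = x = (x\triangleleft^{-1}y)\triangleleft y$ and $(x\triangleleft y)\triangleleft z=(x\triangleleft z)\triangleleft(y\triangleleft z)$ for all $x,y,z$. A quandle is a rack with $x\triangleleft x=x$ for all $x$. Morphisms are maps preserving the operations. For a map $f$, $\mathrm{Eq}(f)=\{(a,b)\mid f(a)=f(b)\}$. Covering: a surjective morphism $f\colon A\to B$ such that $(x\triangleleft a)\triangleleft^{-1} b = x$ for all $x\in A$ and all $(a,b)\in\mathrm{Eq}(f)$. Group of paths: for a rack (or quandle) $X$, $\mathrm{Pth}(X)$ is the group with generators $\underline{x}$ ($x\in X$) and relations $\underline{x\triangleleft a}=\underline a^{-1}\,\underline x\,\underline a$ ($x,a\in X$). A morphism $f\colon X\to Y$ induces the group homomorphism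 $\vec f=\mathrm{Pth}(f)\colon\mathrm{Pth}(X)\to\mathrm{Pth}(Y)$, $\underline x\mapsto\underline{f(x)}$. $\mathrm{Pth}(X)$ acts on $X$ on the right, the action being determined by $x\cdot\underline y=x\triangleleft y$. Inner automorphisms: $\mathrm{S}_y\colon X\to X$, $x\mapsto x\triangleleft y$, is an automorphism; $\mathrm{Inn}(X)$ is the subgroup of $\mathrm{Aut}(X)$ generated by all $\mathrm{S}_y$, with composition written so that it acts on $X$ on the right: $z\cdot(\mathrm S_x\circ \mathrm S_y)=\mathrm S_y(\mathrm S_x(z))$. The homomorphism $s\colon \mathrm{Pth}(X)\to\mathrm{Inn}(X)$ is given by $\underline y\mapsto \mathrm S_y$. Symmetric paths: let $\phi\colon G\to H$ be a group homomorphism and $E\subseteq G$ a generating set. Two elements $g_a,g_b\in G$ are $\phi$-symmetric to each other if there are $n\in\mathbb N$, pairs $(a_1,b_1),\dots,(a_n,b_n)\in (E\times E)\cap \mathrm{Eq}(\phi)$ and $\delta_i\in\{-1,1\}$ such that $g_a=a_1^{\delta_1}\cdots a_n^{\delta_n}$ and $g_b=b_1^{\delta_1}\cdots b_n^{\delta_n}$. $\mathrm K_\phi$ is the set of $\phi$-symmetric paths, i.e. of the elements $g_ag_b^{-1}$ with $g_a,g_b$ $\phi$-symmetric to each other; it is a normal subgroup of $G$. For $\phi=\vec f\colon\mathrm{Pth}(A)\to\mathrm{Pth}(B)$ the generating set is $\{\underline a\mid a\in A\}$. *)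

theory Defs
  imports "HOL-Algebra.Elementary_Groups"
begin

section \<open>Racks and quandles\<close>

record 'a rack = "'a partial_object" +
  rop :: "'a \<Rightarrow> 'a \<Rightarrow> 'a"  (infixl \<open>\<triangleleft>\<index>\<close> 70)
  rinv :: "'a \<Rightarrow> 'a \<Rightarrow> 'a"  (infixl \<open>\<triangleleft>\<inverse>\<index>\<close> 70)

locale rack =
  fixes X :: "('a, 'm) rack_scheme" (structure)
  assumes op_closed: "x \<in> carrier X \<Longrightarrow> y \<in> carrier X \<Longrightarrow> x \<triangleleft> y \<in> carrier X"
    and inv_closed: "x \<in> carrier X \<Longrightarrow> y \<in> carrier X \<Longrightarrow> x \<triangleleft>\<inverse> y \<in> carrier X"
    and op_inv: "x \<in> carrier X \<Longrightarrow> y \<in> carrier X \<Longrightarrow> (x \<triangleleft> y) \<triangleleft>\<inverse> y = x"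
    and inv_op: "x \<in> carrier X \<Longrightarrow> y \<in> carrier X \<Longrightarrow> (x \<triangleleft>\<inverse> y) \<triangleleft> y = x"
    and self_distrib: "x \<in> carrier X \<Longrightarrow> y \<in> carrier X \<Longrightarrow> z \<in> carrier X \<Longrightarrow>
      (x \<triangleleft> y) \<triangleleft> z = (x \<triangleleft> z) \<triangleleft> (y \<triangleleft> z)"

locale quandle = rack +
  assumes idem: "x \<in> carrier X \<Longrightarrow> x \<triangleleft> x = x"

definition rack_hom :: "('a, 'm) rack_scheme \<Rightarrow> ('b, 'n) rack_scheme \<Rightarrow> ('a \<Rightarrow> 'b) set" where
  "rack_hom X Y = {f \<in> carrier X \<rightarrow> carrier Y. \<forall>x \<in> carrier X. \<forall>y \<in> carrier X.
     f (x \<triangleleft>\<^bsub>X\<^esub> y) = f x \<triangleleft>\<^bsub>Y\<^esub> f y \<and> f (x \<triangleleft>\<inverse>\<^bsub>X\<^esub> y) = f x \<triangleleft>\<inverse>\<^bsub>Y\<^esub> f y}"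

definition kernel_pair :: "'a set \<Rightarrow> ('a \<Rightarrow> 'b) \<Rightarrow> ('a \<times> 'a) set" where
  "kernel_pair S f = {(a, b) \<in> S \<times> S. f a = f b}"

definition rack_covering ::
  "('a, 'm) rack_scheme \<Rightarrow> ('b, 'n) rack_scheme \<Rightarrow> ('a \<Rightarrow> 'b) \<Rightarrow> bool" where
  "rack_covering A B f \<longleftrightarrow> f \<in> rack_hom A B \<and> f ` carrier A = carrier B \<and>
     (\<forall>x \<in> carrier A. \<forall>(a, b) \<in> kernel_pair (carrier A) f. (x \<triangleleft>\<^bsub>A\<^esub> a) \<triangleleft>\<inverse>\<^bsub>A\<^esub> b = x)"


section \<open>Groups presented by generators and relations\<close>

text \<open>Group words are lists of signed letters: \<open>(x, True)\<close> stands for the generator \<open>x\<close> and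
  \<open>(x, False)\<close> for its inverse. A relation is a pair of words to be identified.\<close>

type_synonym 'a word = "('a \<times> bool) list"

abbreviation words :: "'a set \<Rightarrow> 'a word set" where
  "words S \<equiv> lists (S \<times> UNIV)"

inductive_set word_cong :: "'a set \<Rightarrow> ('a word \<times> 'a word) set \<Rightarrow> ('a word \<times> 'a word) set"
  for S R where
  relation: "(u, v) \<in> R \<Longrightarrow> u \<in> words S \<Longrightarrow> v \<in> words S \<Longrightarrow> (u, v) \<in> word_cong S R"
| cancel: "x \<in> S \<Longrightarrow> ([(x, e), (x, \<not> e)], []) \<in> word_cong S R"
| append: "(u, u') \<in> word_cong S R \<Longrightarrow> (v, v') \<in> word_cong S R \<Longrightarrow> (u @ v, u' @ v') \<in> word_cong S R"
| refl: "u \<in> words S \<Longrightarrow> (u, u) \<in> word_cong S R"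
| sym: "(u, v) \<in> word_cong S R \<Longrightarrow> (v, u) \<in> word_cong S R"
| trans: "(u, v) \<in> word_cong S R \<Longrightarrow> (v, w) \<in> word_cong S R \<Longrightarrow> (u, w) \<in> word_cong S R"

definition presented_group :: "'a set \<Rightarrow> ('a word \<times> 'a word) set \<Rightarrow> 'a word set monoid" where
  "presented_group S R =
     \<lparr>carrier = words S // word_cong S R,
      monoid.mult = (\<lambda>U V. \<Union>u \<in> U. \<Union>v \<in> V. word_cong S R `` {u @ v}),
      one = word_cong S R `` {[]}\<rparr>"

fun word_eval :: "('g, 'm) monoid_scheme \<Rightarrow> ('a \<Rightarrow> 'g) \<Rightarrow> 'a word \<Rightarrow> 'g" where
  "word_eval G h [] = \<one>\<^bsub>G\<^esub>"
| "word_eval G h ((x, e) # w) = (if e then h x else inv\<^bsub>G\<^esub> h x) \<otimes>\<^bsub>G\<^esub> word_eval G h w"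

text \<open>The map out of a presented group determined by \<open>h\<close> on generators. It is meaningful when
  \<open>h\<close> respects the relations, so that \<open>word_eval G h\<close> is constant on congruence classes;
  see \<open>presented_lift_class\<close> and \<open>presented_lift_hom\<close> below.\<close>

definition presented_lift :: "('g, 'm) monoid_scheme \<Rightarrow> ('a \<Rightarrow> 'g) \<Rightarrow> 'a word set \<Rightarrow> 'g" where
  "presented_lift G h U = the_elem (word_eval G h ` U)"


section \<open>The group of paths and its action\<close>

definition Pth_rels :: "('a, 'm) rack_scheme \<Rightarrow> ('a word \<times> 'a word) set" where
  "Pth_rels X = {([(x \<triangleleft>\<^bsub>X\<^esub> a, True)], [(a, False), (x, True), (a, True)]) | x a.
     x \<in> carrier X \<and> a \<in> carrier X}"

definition Pth :: "('a, 'm) rack_scheme \<Rightarrow> 'a word set monoid" where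
  "Pth X = presented_group (carrier X) (Pth_rels X)"

definition Pth_gen :: "('a, 'm) rack_scheme \<Rightarrow> 'a \<Rightarrow> 'a word set" where
  "Pth_gen X x = word_cong (carrier X) (Pth_rels X) `` {[(x, True)]}"

definition Pth_map :: "('b, 'n) rack_scheme \<Rightarrow> ('a \<Rightarrow> 'b) \<Rightarrow> 'a word set \<Rightarrow> 'b word set" where
  "Pth_map Y f = presented_lift (Pth Y) (\<lambda>x. Pth_gen Y (f x))"

fun word_act :: "('a, 'm) rack_scheme \<Rightarrow> 'a \<Rightarrow> 'a word \<Rightarrow> 'a" where
  "word_act X x [] = x"
| "word_act X x ((y, e) # w) = word_act X (if e then x \<triangleleft>\<^bsub>X\<^esub> y else x \<triangleleft>\<inverse>\<^bsub>X\<^esub> y) w"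

definition path_act :: "('a, 'm) rack_scheme \<Rightarrow> 'a \<Rightarrow> 'a word set \<Rightarrow> 'a" where
  "path_act X x g = the_elem (word_act X x ` g)"

definition acts_trivially :: "('a, 'm) rack_scheme \<Rightarrow> 'a word set set \<Rightarrow> bool" where
  "acts_trivially X K \<longleftrightarrow> (\<forall>x \<in> carrier X. \<forall>g \<in> K. path_act X x g = x)"


section \<open>Inner automorphisms\<close>

text \<open>Automorphisms are composed in diagrammatic order (first \<open>g\<close>, then \<open>h\<close>), so that they act
  on the right. They are \<open>extensional\<close>, i.e. \<open>undefined\<close> off the carrier, so that they
  are determined by their values on the rack.\<close>

definition rack_Aut :: "('a, 'm) rack_scheme \<Rightarrow> ('a \<Rightarrow> 'a) monoid" where
  "rack_Aut X =
     \<lparr>carrier = {h \<in> rack_hom X X \<inter> extensional (carrier X). bij_betw h (carrier X) (carrier X)},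
      monoid.mult = (\<lambda>g h. compose (carrier X) h g),
      one = (\<lambda>x \<in> carrier X. x)\<rparr>"

definition right_transl :: "('a, 'm) rack_scheme \<Rightarrow> 'a \<Rightarrow> 'a \<Rightarrow> 'a" where
  "right_transl X y = (\<lambda>x \<in> carrier X. x \<triangleleft>\<^bsub>X\<^esub> y)"

definition rack_Inn :: "('a, 'm) rack_scheme \<Rightarrow> ('a \<Rightarrow> 'a) monoid" where
  "rack_Inn X = subgroup_generated (rack_Aut X) (right_transl X ` carrier X)"

definition Pth_to_Inn :: "('a, 'm) rack_scheme \<Rightarrow> 'a word set \<Rightarrow> 'a \<Rightarrow> 'a" where
  "Pth_to_Inn X = presented_lift (rack_Inn X) (right_transl X)"


section \<open>Symmetric paths\<close>

definition ordered_prod :: "('g, 'm) monoid_scheme \<Rightarrow> 'g list \<Rightarrow> 'g" where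
  "ordered_prod G gs = foldr (\<otimes>\<^bsub>G\<^esub>) gs \<one>\<^bsub>G\<^esub>"

definition symmetric_pair ::
  "('g, 'm) monoid_scheme \<Rightarrow> ('g \<Rightarrow> 'h) \<Rightarrow> 'g set \<Rightarrow> 'g \<Rightarrow> 'g \<Rightarrow> bool" where
  "symmetric_pair G \<phi> E ga gb \<longleftrightarrow>
     (\<exists>(n::nat) (a :: nat \<Rightarrow> 'g) (b :: nat \<Rightarrow> 'g) (\<delta> :: nat \<Rightarrow> int).
        (\<forall>i<n. (a i, b i) \<in> (E \<times> E) \<inter> kernel_pair (carrier G) \<phi> \<and> \<delta> i \<in> {-1, 1}) \<and>
        ga = ordered_prod G (map (\<lambda>i. a i [^]\<^bsub>G\<^esub> \<delta> i) [0..<n]) \<and>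
        gb = ordered_prod G (map (\<lambda>i. b i [^]\<^bsub>G\<^esub> \<delta> i) [0..<n]))"

definition symmetric_paths ::
  "('g, 'm) monoid_scheme \<Rightarrow> ('g \<Rightarrow> 'h) \<Rightarrow> 'g set \<Rightarrow> 'g set" where
  "symmetric_paths G \<phi> E = {ga \<otimes>\<^bsub>G\<^esub> inv\<^bsub>G\<^esub> gb | ga gb. symmetric_pair G \<phi> E ga gb}"


section \<open>Well-definedness\<close>

lemma word_cong_words: "(u, v) \<in> word_cong S R \<Longrightarrow> u \<in> words S \<and> v \<in> words S"
  by (induction rule: word_cong.induct) auto

lemma equiv_word_cong: "equiv (words S) (word_cong S R)"
proof (rule equivI)
  show "word_cong S R \<subseteq> words S \<times> words S" by (auto dest: word_cong_words simp del: in_lists_conv_set)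
  show "refl_on (words S) (word_cong S R)" by (rule refl_onI) (rule word_cong.refl)
  show "sym (word_cong S R)" by (rule symI) (rule word_cong.sym)
  show "trans (word_cong S R)" by (rule transI) (rule word_cong.trans)
qed

lemma word_class_eq: "(u, v) \<in> word_cong S R \<Longrightarrow> word_cong S R `` {u} = word_cong S R `` {v}"
  by (rule equiv_class_eq[OF equiv_word_cong])

lemma presented_group_mult:
  assumes "u \<in> words S" "v \<in> words S"
  shows "word_cong S R `` {u} \<otimes>\<^bsub>presented_group S R\<^esub> word_cong S R `` {v} = word_cong S R `` {u @ v}"
proof -
  have "(u @ v, w) \<in> word_cong S R"
    if "(u, u') \<in> word_cong S R" "(v, v') \<in> word_cong S R" "(u' @ v', w) \<in> word_cong S R" for u' v' w
    by (rule word_cong.trans[OF word_cong.append[OF that(1,2)] that(3)])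
  moreover note word_cong.refl[OF assms(1)] word_cong.refl[OF assms(2)]
  ultimately have "(\<Union>u' \<in> word_cong S R `` {u}. \<Union>v' \<in> word_cong S R `` {v}. word_cong S R `` {u' @ v'})
      = word_cong S R `` {u @ v}"
    by (intro equalityI subsetI) (simp_all only: UN_iff Image_singleton_iff bex_simps Bex_def, blast+)
  thus ?thesis unfolding presented_group_def monoid.simps .
qed

lemma presented_group_carrierE:
  assumes "U \<in> carrier (presented_group S R)"
  obtains u where "u \<in> words S" "U = word_cong S R `` {u}"
proof -
  have "U \<in> words S // word_cong S R" using assms by (simp add: presented_group_def)
  then obtain u where "u \<in> words S" "U = word_cong S R `` {u}" unfolding quotient_def by blast
  thus ?thesis by (rule that)
qed

lemma presented_group_classI: "u \<in> words S \<Longrightarrow> word_cong S R `` {u} \<in> carrier (presented_group S R)"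
  unfolding presented_group_def by (auto intro!: quotientI simp del: in_lists_conv_set)

lemma word_left_inverse:
  assumes "u \<in> words S"
  shows "\<exists>v \<in> words S. (v @ u, []) \<in> word_cong S R"
  using assms
proof (induction u)
  case Nil
  show ?case by (rule bexI[of _ "[]"]) (auto intro: word_cong.refl)
next
  case (Cons p u)
  obtain x e where p: "p = (x, e)" by force
  with Cons obtain v where v: "v \<in> words S" "(v @ u, []) \<in> word_cong S R" and x: "x \<in> S"
    and u: "u \<in> words S" by auto
  have "([(x, \<not> e), (x, \<not> \<not> e)], []) \<in> word_cong S R" using x by (rule word_cong.cancel)
  hence "([(x, \<not> e), (x, e)], []) \<in> word_cong S R" by simp
  from word_cong.append[OF this word_cong.refl[OF u]]
  have "((x, \<not> e) # (x, e) # u, u) \<in> word_cong S R" by simp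
  from word_cong.append[OF word_cong.refl[OF v(1)] this]
  have "(v @ (x, \<not> e) # (x, e) # u, []) \<in> word_cong S R" using v(2) by (rule word_cong.trans)
  thus ?case using v(1) x p by (intro bexI[of _ "v @ [(x, \<not> e)]"]) auto
qed

lemma group_presented_group: "group (presented_group S R)"
proof (rule groupI)
  let ?G = "presented_group S R" and ?c = "\<lambda>u. word_cong S R `` {u}"
  have one: "\<one>\<^bsub>?G\<^esub> = ?c []" by (simp add: presented_group_def)
  show "\<one>\<^bsub>?G\<^esub> \<in> carrier ?G" unfolding one by (rule presented_group_classI) simp
  fix U assume "U \<in> carrier ?G"
  then obtain u where u: "u \<in> words S" "U = ?c u" by (rule presented_group_carrierE)
  show "\<one>\<^bsub>?G\<^esub> \<otimes>\<^bsub>?G\<^esub> U = U"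
    using u by (simp add: one presented_group_mult)
  obtain v' where v': "v' \<in> words S" "(v' @ u, []) \<in> word_cong S R"
    using word_left_inverse[OF u(1)] by blast
  have "?c v' \<otimes>\<^bsub>?G\<^esub> U = \<one>\<^bsub>?G\<^esub>"
    unfolding one u(2) presented_group_mult[OF v'(1) u(1)] by (rule word_class_eq[OF v'(2)])
  thus "\<exists>V \<in> carrier ?G. V \<otimes>\<^bsub>?G\<^esub> U = \<one>\<^bsub>?G\<^esub>"
    using presented_group_classI[OF v'(1)] by blast
  fix V assume "V \<in> carrier ?G"
  then obtain v where v: "v \<in> words S" "V = ?c v" by (rule presented_group_carrierE)
  show "U \<otimes>\<^bsub>?G\<^esub> V \<in> carrier ?G"
    using u v presented_group_classI[of "u @ v" S R] by (simp add: presented_group_mult)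
  fix W assume "W \<in> carrier ?G"
  then obtain w where w: "w \<in> words S" "W = ?c w" by (rule presented_group_carrierE)
  show "U \<otimes>\<^bsub>?G\<^esub> V \<otimes>\<^bsub>?G\<^esub> W = U \<otimes>\<^bsub>?G\<^esub> (V \<otimes>\<^bsub>?G\<^esub> W)"
    using u v w by (simp add: presented_group_mult)
qed

context group
begin

lemma word_eval_closed:
  assumes "h \<in> S \<rightarrow> carrier G" "w \<in> words S"
  shows "word_eval G h w \<in> carrier G"
  using assms(2)
proof (induction w)
  case (Cons p w)
  thus ?case using assms(1) by (cases p) auto
qed simp

lemma word_eval_append:
  assumes "h \<in> S \<rightarrow> carrier G" "u \<in> words S" "v \<in> words S"
  shows "word_eval G h (u @ v) = word_eval G h u \<otimes> word_eval G h v"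
  using assms(2)
proof (induction u)
  case Nil
  show ?case using word_eval_closed[OF assms(1,3)] by simp
next
  case (Cons p u)
  obtain x e where p: "p = (x, e)" by force
  have "h x \<in> carrier G" using Cons.hyps p assms(1) by auto
  thus ?case using Cons p word_eval_closed[OF assms(1)] assms(3) by (auto simp: m_assoc)
qed

lemma word_eval_cong:
  assumes h: "h \<in> S \<rightarrow> carrier G"
    and R: "\<And>u v. (u, v) \<in> R \<Longrightarrow> u \<in> words S \<Longrightarrow> v \<in> words S \<Longrightarrow> word_eval G h u = word_eval G h v"
    and uv: "(u, v) \<in> word_cong S R"
  shows "word_eval G h u = word_eval G h v"
  using uv
proof (induction rule: word_cong.induct)
  case (cancel x e)
  hence "h x \<in> carrier G" using h by auto
  thus ?case by (cases e) simp_all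
next
  case (append u u' v v')
  thus ?case using word_eval_append[OF h] word_cong_words by metis
qed (use R in auto)

lemma presented_lift_class:
  assumes h: "h \<in> S \<rightarrow> carrier G"
    and R: "\<And>u v. (u, v) \<in> R \<Longrightarrow> u \<in> words S \<Longrightarrow> v \<in> words S \<Longrightarrow> word_eval G h u = word_eval G h v"
    and u: "u \<in> words S"
  shows "presented_lift G h (word_cong S R `` {u}) = word_eval G h u"
proof -
  have "word_eval G h ` (word_cong S R `` {u}) = {word_eval G h u}"
  proof (intro equalityI subsetI)
    fix y assume "y \<in> word_eval G h ` (word_cong S R `` {u})"
    then obtain v where "(u, v) \<in> word_cong S R" "y = word_eval G h v" by blast
    thus "y \<in> {word_eval G h u}" using word_eval_cong[OF h R, of R u v] by simp
  qed (use word_cong.refl[OF u] in blast)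
  thus ?thesis by (simp add: presented_lift_def)
qed

lemma presented_lift_hom:
  assumes h: "h \<in> S \<rightarrow> carrier G"
    and R: "\<And>u v. (u, v) \<in> R \<Longrightarrow> u \<in> words S \<Longrightarrow> v \<in> words S \<Longrightarrow> word_eval G h u = word_eval G h v"
  shows "presented_lift G h \<in> hom (presented_group S R) G"
proof (rule homI)
  note lift = presented_lift_class[OF h R]
  fix U assume "U \<in> carrier (presented_group S R)"
  then obtain u where u: "u \<in> words S" "U = word_cong S R `` {u}"
    by (rule presented_group_carrierE)
  show "presented_lift G h U \<in> carrier G"
    using lift[OF _ _ _ u(1)] word_eval_closed[OF h u(1)] u(2) by simp
  fix V assume "V \<in> carrier (presented_group S R)"
  then obtain v where v: "v \<in> words S" "V = word_cong S R `` {v}"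
    by (rule presented_group_carrierE)
  show "presented_lift G h (U \<otimes>\<^bsub>presented_group S R\<^esub> V) = presented_lift G h U \<otimes> presented_lift G h V"
    using u v by (simp add: presented_group_mult lift word_eval_append[OF h])
qed

end

lemma group_Pth: "group (Pth X)"
  unfolding Pth_def by (rule group_presented_group)

lemma Pth_gen_closed: "x \<in> carrier X \<Longrightarrow> Pth_gen X x \<in> carrier (Pth X)"
  unfolding Pth_def Pth_gen_def by (auto intro: presented_group_classI)

context rack
begin

lemma word_act_append: "word_act X x (u @ v) = word_act X (word_act X x u) v"
  by (induction u arbitrary: x) auto

lemma word_act_closed: "x \<in> carrier X \<Longrightarrow> w \<in> words (carrier X) \<Longrightarrow> word_act X x w \<in> carrier X"
proof (induction w arbitrary: x)
  case (Cons p w)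
  thus ?case by (cases p) (auto simp: op_closed inv_closed)
qed simp

lemma word_act_cong:
  assumes "(u, v) \<in> word_cong (carrier X) (Pth_rels X)" "x \<in> carrier X"
  shows "word_act X x u = word_act X x v"
  using assms
proof (induction arbitrary: x rule: word_cong.induct)
  case (relation u v)
  then obtain y a where ya: "y \<in> carrier X" "a \<in> carrier X" "u = [(y \<triangleleft> a, True)]"
    "v = [(a, False), (y, True), (a, True)]" by (auto simp: Pth_rels_def)
  thus ?case using relation.prems self_distrib[of "x \<triangleleft>\<inverse> a" y a]
    by (simp add: inv_closed inv_op)
next
  case (cancel y e)
  thus ?case by (cases e) (auto simp: op_inv inv_op)
next
  case (append u u' v v')
  thus ?case by (metis word_act_append word_act_closed word_cong_words)
qed auto

lemma path_act_class:
  assumes "u \<in> words (carrier X)" "x \<in> carrier X"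
  shows "path_act X x (word_cong (carrier X) (Pth_rels X) `` {u}) = word_act X x u"
proof -
  have "word_act X x ` (word_cong (carrier X) (Pth_rels X) `` {u}) = {word_act X x u}"
  proof (intro equalityI subsetI)
    fix y assume "y \<in> word_act X x ` (word_cong (carrier X) (Pth_rels X) `` {u})"
    then obtain v where "(u, v) \<in> word_cong (carrier X) (Pth_rels X)" "y = word_act X x v" by blast
    thus "y \<in> {word_act X x u}" using word_act_cong[OF _ assms(2)] by simp
  qed (use word_cong.refl[OF assms(1)] in blast)
  thus ?thesis by (simp add: path_act_def)
qed

lemma right_transl_Aut:
  assumes y: "y \<in> carrier X"
  shows "right_transl X y \<in> carrier (rack_Aut X)"
proof -
  have "(x \<triangleleft>\<inverse> z) \<triangleleft> y = (x \<triangleleft> y) \<triangleleft>\<inverse> (z \<triangleleft> y)" if "x \<in> carrier X" "z \<in> carrier X" for x z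
    by (metis that y op_inv inv_op self_distrib op_closed inv_closed)
  moreover have "bij_betw (right_transl X y) (carrier X) (carrier X)"
    by (rule bij_betw_byWitness[where f' = "\<lambda>x. x \<triangleleft>\<inverse> y"])
      (auto simp: right_transl_def y op_closed inv_closed op_inv inv_op)
  ultimately show ?thesis using y
    by (auto simp: rack_Aut_def rack_hom_def right_transl_def op_closed inv_closed self_distrib[OF _ _ y])
qed

lemma group_rack_Aut: "group (rack_Aut X)"
proof (rule groupI)
  let ?A = "rack_Aut X"
  show "\<one>\<^bsub>?A\<^esub> \<in> carrier ?A"
    by (auto simp: rack_Aut_def rack_hom_def op_closed inv_closed bij_betw_def inj_on_def)
  fix g assume g: "g \<in> carrier ?A"
  show "\<one>\<^bsub>?A\<^esub> \<otimes>\<^bsub>?A\<^esub> g = g"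
    using g by (auto simp: rack_Aut_def compose_def fun_eq_iff extensional_def)
  define k where "k = (\<lambda>x \<in> carrier X. inv_into (carrier X) g x)"
  have bij: "bij_betw g (carrier X) (carrier X)" and hom: "g \<in> rack_hom X X"
    using g by (auto simp: rack_Aut_def)
  have bij': "bij_betw k (carrier X) (carrier X)"
    using bij_betw_inv_into[OF bij] by (simp add: k_def bij_betw_def inj_on_def)
  have k: "k x \<in> carrier X" "g (k x) = x" if "x \<in> carrier X" for x
    using that bij by (auto simp: k_def bij_betw_def inv_into_into f_inv_into_f)
  have inj: "x = y" if "g x = g y" "x \<in> carrier X" "y \<in> carrier X" for x y
    using that bij by (auto simp: bij_betw_def inj_on_def)
  have "k (x \<triangleleft> y) = k x \<triangleleft> k y \<and> k (x \<triangleleft>\<inverse> y) = k x \<triangleleft>\<inverse> k y"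
    if "x \<in> carrier X" "y \<in> carrier X" for x y
  proof
    show "k (x \<triangleleft> y) = k x \<triangleleft> k y"
      using that hom k[OF that(1)] k[OF that(2)] k[OF op_closed[OF that]]
      by - (rule inj, simp_all add: rack_hom_def op_closed)
    show "k (x \<triangleleft>\<inverse> y) = k x \<triangleleft>\<inverse> k y"
      using that hom k[OF that(1)] k[OF that(2)] k[OF inv_closed[OF that]]
      by - (rule inj, simp_all add: rack_hom_def inv_closed)
  qed
  hence "k \<in> carrier ?A" using bij' k(1) by (auto simp: rack_Aut_def rack_hom_def k_def)
  moreover have "k \<otimes>\<^bsub>?A\<^esub> g = \<one>\<^bsub>?A\<^esub>"
    using k by (auto simp: rack_Aut_def compose_def fun_eq_iff)
  ultimately show "\<exists>k \<in> carrier ?A. k \<otimes>\<^bsub>?A\<^esub> g = \<one>\<^bsub>?A\<^esub>" by blast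
  fix h assume h: "h \<in> carrier ?A"
  have "compose (carrier X) h g \<in> rack_hom X X"
    using g h by (auto simp: rack_Aut_def rack_hom_def compose_def op_closed inv_closed Pi_def)
  thus "g \<otimes>\<^bsub>?A\<^esub> h \<in> carrier ?A"
    using g h by (auto simp: rack_Aut_def intro: bij_betw_compose)
  fix l assume "l \<in> carrier ?A"
  thus "g \<otimes>\<^bsub>?A\<^esub> h \<otimes>\<^bsub>?A\<^esub> l = g \<otimes>\<^bsub>?A\<^esub> (h \<otimes>\<^bsub>?A\<^esub> l)"
    using g h by (auto simp: rack_Aut_def rack_hom_def compose_def fun_eq_iff Pi_def)
qed

lemma group_rack_Inn: "group (rack_Inn X)"
  unfolding rack_Inn_def using group_rack_Aut by (rule group.group_subgroup_generated)

lemma right_transl_Inn: "y \<in> carrier X \<Longrightarrow> right_transl X y \<in> carrier (rack_Inn X)"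
  unfolding rack_Inn_def
  by (auto simp: carrier_subgroup_generated intro: generate.incl right_transl_Aut)

lemma Pth_to_Inn_hom: "Pth_to_Inn X \<in> hom (Pth X) (rack_Inn X)"
  unfolding Pth_to_Inn_def Pth_def
proof (rule group.presented_lift_hom[OF group_rack_Inn])
  interpret I: group "rack_Inn X" by (rule group_rack_Inn)
  let ?S = "right_transl X"
  show "?S \<in> carrier X \<rightarrow> carrier (rack_Inn X)" using right_transl_Inn by simp
  fix u v assume "(u, v) \<in> Pth_rels X"
  then obtain x a where xa: "x \<in> carrier X" "a \<in> carrier X" and uv: "u = [(x \<triangleleft> a, True)]"
    "v = [(a, False), (x, True), (a, True)]" by (auto simp: Pth_rels_def)
  note S = right_transl_Inn[OF xa(1)] right_transl_Inn[OF xa(2)] right_transl_Inn[OF op_closed[OF xa]]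
  have "?S a \<otimes>\<^bsub>rack_Inn X\<^esub> ?S (x \<triangleleft> a) = ?S x \<otimes>\<^bsub>rack_Inn X\<^esub> ?S a"
    using xa by (auto simp: rack_Inn_def subgroup_generated_def rack_Aut_def compose_def
        right_transl_def fun_eq_iff op_closed self_distrib[OF _ xa])
  thus "word_eval (rack_Inn X) ?S u = word_eval (rack_Inn X) ?S v"
    using S by (simp add: uv) (metis I.inv_solve_left I.m_closed)
qed

end

lemma Pth_map_hom:
  assumes "rack B" "f \<in> rack_hom A B"
  shows "Pth_map B f \<in> hom (Pth A) (Pth B)"
proof -
  interpret B: group "Pth B" by (rule group_Pth)
  have f: "f x \<in> carrier B" if "x \<in> carrier A" for x using assms(2) that by (auto simp: rack_hom_def)
  have rel: "word_eval (Pth B) (\<lambda>x. Pth_gen B (f x)) u = word_eval (Pth B) (\<lambda>x. Pth_gen B (f x)) v"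
    if "(u, v) \<in> Pth_rels A" for u v
  proof -
    let ?c = "\<lambda>w. word_cong (carrier B) (Pth_rels B) `` {w}" and ?g = "Pth_gen B"
    obtain x a where xa: "x \<in> carrier A" "a \<in> carrier A" and uv: "u = [(x \<triangleleft>\<^bsub>A\<^esub> a, True)]"
      "v = [(a, False), (x, True), (a, True)]" using \<open>(u, v) \<in> Pth_rels A\<close> by (auto simp: Pth_rels_def)
    have op: "f (x \<triangleleft>\<^bsub>A\<^esub> a) = f x \<triangleleft>\<^bsub>B\<^esub> f a" using assms(2) xa by (simp add: rack_hom_def)
    have cl: "f x \<triangleleft>\<^bsub>B\<^esub> f a \<in> carrier B" using rack.op_closed[OF assms(1)] f xa by blast
    note g = Pth_gen_closed[OF f[OF xa(1)]] Pth_gen_closed[OF f[OF xa(2)]] Pth_gen_closed[OF cl]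
    have one: "\<one>\<^bsub>Pth B\<^esub> = ?c []" by (simp add: Pth_def presented_group_def)
    have "([(f a, False), (f a, \<not> False)], []) \<in> word_cong (carrier B) (Pth_rels B)"
      using f[OF xa(2)] by (rule word_cong.cancel)
    hence "?c [(f a, False)] \<otimes>\<^bsub>Pth B\<^esub> ?g (f a) = \<one>\<^bsub>Pth B\<^esub>"
      using word_class_eq f[OF xa(2)] unfolding one
      by (fastforce simp: Pth_gen_def Pth_def presented_group_mult)
    moreover have "?c [(f a, False)] \<in> carrier (Pth B)"
      unfolding Pth_def using f[OF xa(2)] by (auto intro: presented_group_classI)
    ultimately have inv: "inv\<^bsub>Pth B\<^esub> ?g (f a) = ?c [(f a, False)]"
      using B.inv_equality g by blast
    have "([(f x \<triangleleft>\<^bsub>B\<^esub> f a, True)], [(f a, False), (f x, True), (f a, True)])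
        \<in> word_cong (carrier B) (Pth_rels B)"
      using f xa cl by (intro word_cong.relation) (auto simp: Pth_rels_def)
    hence "?g (f x \<triangleleft>\<^bsub>B\<^esub> f a) = ?c [(f a, False), (f x, True), (f a, True)]"
      unfolding Pth_gen_def by (rule word_class_eq)
    also have "\<dots> = ?c [(f a, False)] \<otimes>\<^bsub>Pth B\<^esub> (?g (f x) \<otimes>\<^bsub>Pth B\<^esub> ?g (f a))"
      unfolding Pth_def Pth_gen_def using f xa by (simp add: presented_group_mult)
    finally show ?thesis using g inv[symmetric] by (simp add: uv op)
  qed
  show ?thesis unfolding Pth_map_def Pth_def[of A]
    by (rule B.presented_lift_hom[OF Pi_I]) (rule Pth_gen_closed[OF f], assumption, rule rel)
qed

end

theory Submission
  imports Defs
begin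

text \<open>Words in the elements of a rack act on the rack on the right, and the action of a path is that
  of any word representing it. In these terms the homomorphism \<open>Pth_map B f\<close> relabels the letters of
  a word along \<open>f\<close>, and \<open>Pth_to_Inn A\<close> sends a path to the map by which it acts. The latter makes
  \<open>Ker s\<close> the subgroup of all paths that act trivially, so that a subgroup of \<open>Pth A\<close> acts trivially
  exactly when it lies in \<open>Ker s\<close> (\<open>acts_trivially_iff_subgroup_kernel\<close>).

  The heart of the matter is that the kernel of \<open>Pth_map B f\<close> acts trivially when \<open>f\<close> is a covering.
  For a covering, \<open>x \<triangleleft> a\<close> depends on \<open>a\<close> only through \<open>f a\<close>, so an element \<open>b\<close> of \<open>B\<close> acts on \<open>A\<close>
  through any of its preimages. A preimage of \<open>y \<triangleleft> b\<close> can be computed from preimages of \<open>y\<close> and \<open>b\<close>,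
  hence the defining relations of \<open>Pth B\<close> hold for this action because those of \<open>Pth A\<close> do: the action
  of \<open>Pth A\<close> on \<open>A\<close> factors through \<open>Pth B\<close>, and whatever dies in \<open>Pth B\<close> acts trivially
  (\<open>word_act_lift_cong\<close>, \<open>covering_kernel_acts_trivially\<close>).

  Two easy facts close the circle. The two members of a symmetric pair have the same image, letter
  by letter, so symmetric paths lie in the kernel; and if \<open>f a = f b\<close>, the generators of \<open>a\<close> and
  \<open>b\<close> form a symmetric pair of length one, for which trivial action of their quotient is the covering
  condition.

  A direct proof that coverings make symmetric paths act trivially would meet an obstacle that the
  detour through the kernel avoids: a symmetric pair only requires equality of the generators of
  \<open>f a\<close> and \<open>f b\<close> in \<open>Pth B\<close>, which does not imply \<open>f a = f b\<close> in general.\<close>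

abbreviation relabel :: "('a \<Rightarrow> 'b) \<Rightarrow> 'a word \<Rightarrow> 'b word" where
  "relabel f \<equiv> map (apfst f)"

abbreviation path_of :: "('a, 'm) rack_scheme \<Rightarrow> 'a word \<Rightarrow> 'a word set" where
  "path_of X u \<equiv> word_cong (carrier X) (Pth_rels X) `` {u}"

lemma the_elem_word_class:
  assumes "u \<in> words S" and "\<And>v. (u, v) \<in> word_cong S R \<Longrightarrow> F v = F u"
  shows "the_elem (F ` (word_cong S R `` {u})) = F u"
proof -
  have "F ` (word_cong S R `` {u}) = {F u}"
  proof (intro equalityI subsetI)
    fix y assume "y \<in> F ` (word_cong S R `` {u})"
    then obtain v where "y = F v" "(u, v) \<in> word_cong S R" by (elim imageE) simp
    thus "y \<in> {F u}" using assms(2)[of v] by simp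
  next
    fix y assume "y \<in> {F u}"
    thus "y \<in> F ` (word_cong S R `` {u})"
      using word_cong.refl[OF assms(1)] by (intro image_eqI[of _ _ u]) simp_all
  qed
  thus ?thesis by simp
qed

lemma relabel_words: "u \<in> words S \<Longrightarrow> f \<in> S \<rightarrow> T \<Longrightarrow> relabel f u \<in> words T"
  by (induction u) (auto simp: Pi_iff)

lemma Pth_carrierE:
  assumes "g \<in> carrier (Pth X)"
  obtains u where "u \<in> words (carrier X)" "g = path_of X u"
  using assms unfolding Pth_def by (rule presented_group_carrierE)

lemma path_of_closed: "u \<in> words (carrier X) \<Longrightarrow> path_of X u \<in> carrier (Pth X)"
  unfolding Pth_def by (rule presented_group_classI)

lemma path_of_append:
  "u \<in> words (carrier X) \<Longrightarrow> v \<in> words (carrier X) \<Longrightarrow>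
    path_of X u \<otimes>\<^bsub>Pth X\<^esub> path_of X v = path_of X (u @ v)"
  unfolding Pth_def by (rule presented_group_mult)

lemma one_Pth: "\<one>\<^bsub>Pth X\<^esub> = path_of X []"
  by (simp add: Pth_def presented_group_def)

lemma inv_Pth_gen:
  assumes x: "x \<in> carrier X"
  shows "inv\<^bsub>Pth X\<^esub> Pth_gen X x = path_of X [(x, False)]"
proof -
  interpret P: group "Pth X" by (rule group_Pth)
  have "([(x, False), (x, \<not> False)], []) \<in> word_cong (carrier X) (Pth_rels X)"
    using x by (rule word_cong.cancel)
  hence "path_of X [(x, False), (x, True)] = path_of X []"
    by (intro word_class_eq) simp
  hence "path_of X [(x, False)] \<otimes>\<^bsub>Pth X\<^esub> Pth_gen X x = \<one>\<^bsub>Pth X\<^esub>"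
    using x by (simp add: Pth_gen_def path_of_append one_Pth)
  thus ?thesis
    using x by (intro P.inv_equality) (simp_all add: Pth_gen_closed path_of_closed)
qed


section \<open>The induced homomorphism relabels words\<close>

lemma rack_homD:
  assumes "f \<in> rack_hom X Y" "x \<in> carrier X"
  shows "f x \<in> carrier Y"
    and "y \<in> carrier X \<Longrightarrow> f (x \<triangleleft>\<^bsub>X\<^esub> y) = f x \<triangleleft>\<^bsub>Y\<^esub> f y"
  using assms by (auto simp: rack_hom_def)

text \<open>A morphism carries the defining relations of \<open>Pth A\<close> to those of \<open>Pth B\<close>.\<close>

lemma relabel_cong:
  assumes "f \<in> rack_hom A B" and "(u, v) \<in> word_cong (carrier A) (Pth_rels A)"
  shows "(relabel f u, relabel f v) \<in> word_cong (carrier B) (Pth_rels B)"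
  using assms(2)
proof (induction rule: word_cong.induct)
  case (relation u v)
  have f: "f \<in> carrier A \<rightarrow> carrier B" using assms(1) by (simp add: rack_hom_def)
  have "(relabel f u, relabel f v) \<in> Pth_rels B"
    using relation rack_homD[OF assms(1)] by (fastforce simp: Pth_rels_def)
  thus ?case using relation relabel_words[OF _ f] by (intro word_cong.relation)
next
  case (cancel x e)
  thus ?case using word_cong.cancel[of "f x" "carrier B"] rack_homD(1)[OF assms(1)] by simp
next
  case (append u u' v v')
  thus ?case using word_cong.append by fastforce
next
  case (refl u)
  thus ?case using assms(1) by (intro word_cong.refl relabel_words) (auto simp: rack_hom_def)
qed (blast intro: word_cong.sym word_cong.trans)+

lemma word_eval_Pth_gen:
  assumes "f \<in> carrier A \<rightarrow> carrier B" "u \<in> words (carrier A)"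
  shows "word_eval (Pth B) (\<lambda>x. Pth_gen B (f x)) u = path_of B (relabel f u)"
  using assms(2)
proof (induction u)
  case Nil
  show ?case by (simp add: one_Pth)
next
  case (Cons p u)
  obtain x e where p: "p = (x, e)" by force
  have x: "f x \<in> carrier B" and u: "relabel f u \<in> words (carrier B)"
    using Cons.hyps p assms(1) relabel_words[of u "carrier A" f "carrier B"] by auto
  have "(if e then Pth_gen B (f x) else inv\<^bsub>Pth B\<^esub> Pth_gen B (f x)) = path_of B [(f x, e)]"
    using x by (simp add: inv_Pth_gen Pth_gen_def[symmetric])
  thus ?case using x u Cons.IH path_of_append[of "[(f x, e)]" B "relabel f u"]
    by (simp add: p)
qed

lemma Pth_map_path_of:
  assumes f: "f \<in> rack_hom A B" and u: "u \<in> words (carrier A)"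
  shows "Pth_map B f (path_of A u) = path_of B (relabel f u)"
proof -
  have f': "f \<in> carrier A \<rightarrow> carrier B" using f by (simp add: rack_hom_def)
  let ?F = "word_eval (Pth B) (\<lambda>x. Pth_gen B (f x))"
  have "?F v = ?F u" if "(u, v) \<in> word_cong (carrier A) (Pth_rels A)" for v
    using word_cong_words[OF that] word_class_eq[OF relabel_cong[OF f that]]
      word_eval_Pth_gen[OF f', of u] word_eval_Pth_gen[OF f', of v] by metis
  hence "Pth_map B f (path_of A u) = ?F u"
    unfolding Pth_map_def presented_lift_def by (rule the_elem_word_class[OF u])
  thus ?thesis by (simp only: word_eval_Pth_gen[OF f' u])
qed


section \<open>Paths acting trivially form the kernel of the map to inner automorphisms\<close>

context rack
begin

lemma one_rack_Inn: "\<one>\<^bsub>rack_Inn X\<^esub> = (\<lambda>x \<in> carrier X. x)"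
  by (simp add: rack_Inn_def subgroup_generated_def rack_Aut_def)

lemma mult_rack_Inn: "g \<otimes>\<^bsub>rack_Inn X\<^esub> h = compose (carrier X) h g"
  by (simp add: rack_Inn_def subgroup_generated_def rack_Aut_def)

lemma inv_right_transl_apply:
  assumes y: "y \<in> carrier X" and x: "x \<in> carrier X"
  shows "(inv\<^bsub>rack_Inn X\<^esub> right_transl X y) x = x \<triangleleft>\<inverse> y"
proof -
  interpret I: group "rack_Inn X" by (rule group_rack_Inn)
  let ?i = "inv\<^bsub>rack_Inn X\<^esub> right_transl X y"
  \<comment> \<open>Evaluating \<open>S_y S_y\<inverse> = 1\<close> at \<open>x \<triangleleft>\<inverse> y\<close>, which the first factor sends to \<open>x\<close>.\<close>
  have "(right_transl X y \<otimes>\<^bsub>rack_Inn X\<^esub> ?i) (x \<triangleleft>\<inverse> y) = x \<triangleleft>\<inverse> y"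
    using right_transl_Inn[OF y] x y by (simp add: one_rack_Inn inv_closed)
  thus ?thesis using x y
    by (simp add: mult_rack_Inn compose_def right_transl_def inv_closed inv_op)
qed

lemma word_eval_right_transl:
  assumes "u \<in> words (carrier X)"
  shows "word_eval (rack_Inn X) (right_transl X) u = (\<lambda>x \<in> carrier X. word_act X x u)"
  using assms
proof (induction u)
  case Nil
  show ?case by (simp add: one_rack_Inn)
next
  case (Cons p u)
  obtain y e where p: "p = (y, e)" by force
  have "y \<in> carrier X" using Cons.hyps p by auto
  thus ?case using Cons.IH
    by (auto simp: p mult_rack_Inn compose_def fun_eq_iff inv_right_transl_apply
        right_transl_def[of X y, THEN fun_cong] op_closed inv_closed)
qed

lemma Pth_to_Inn_path_of:
  assumes u: "u \<in> words (carrier X)"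
  shows "Pth_to_Inn X (path_of X u) = (\<lambda>x \<in> carrier X. path_act X x (path_of X u))"
proof -
  let ?F = "word_eval (rack_Inn X) (right_transl X)"
  have "?F v = ?F u" if "(u, v) \<in> word_cong (carrier X) (Pth_rels X)" for v
    using word_cong_words[OF that] word_act_cong[OF that]
    by (simp only: word_eval_right_transl) (simp add: fun_eq_iff)
  hence "Pth_to_Inn X (path_of X u) = ?F u"
    unfolding Pth_to_Inn_def presented_lift_def by (rule the_elem_word_class[OF u])
  thus ?thesis using path_act_class[OF u] by (simp add: word_eval_right_transl[OF u] fun_eq_iff)
qed

lemma kernel_Pth_to_Inn:
  "kernel (Pth X) (rack_Inn X) (Pth_to_Inn X) =
    {g \<in> carrier (Pth X). \<forall>x \<in> carrier X. path_act X x g = x}"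
proof -
  have "Pth_to_Inn X g = \<one>\<^bsub>rack_Inn X\<^esub> \<longleftrightarrow> (\<forall>x \<in> carrier X. path_act X x g = x)"
    if "g \<in> carrier (Pth X)" for g
    using that by (rule Pth_carrierE)
      (auto simp: Pth_to_Inn_path_of one_rack_Inn fun_eq_iff restrict_def)
  thus ?thesis by (auto simp: kernel_def)
qed

end

lemma acts_trivially_iff_subgroup_kernel:
  assumes "rack X" and K: "subgroup K (Pth X)"
  shows "acts_trivially X K \<longleftrightarrow>
    subgroup K (Pth X\<lparr>carrier := kernel (Pth X) (rack_Inn X) (Pth_to_Inn X)\<rparr>)"
proof -
  interpret rack X by fact
  interpret s: group_hom "Pth X" "rack_Inn X" "Pth_to_Inn X"
    using group_Pth group_rack_Inn Pth_to_Inn_hom by (intro group_hom.intro group_hom_axioms.intro)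
  let ?N = "kernel (Pth X) (rack_Inn X) (Pth_to_Inn X)"
  have "subgroup K (Pth X\<lparr>carrier := ?N\<rparr>) \<longleftrightarrow> K \<subseteq> ?N"
    using s.G.subgroup_incl[OF K s.subgroup_kernel] subgroup.subset by fastforce
  also have "\<dots> \<longleftrightarrow> acts_trivially X K"
    using subgroup.subset[OF K] by (auto simp: kernel_Pth_to_Inn acts_trivially_def)
  finally show ?thesis by simp
qed


section \<open>Symmetric paths lie in the kernel\<close>

lemma (in monoid) ordered_prod_closed:
  "set gs \<subseteq> carrier G \<Longrightarrow> ordered_prod G gs \<in> carrier G"
  by (induction gs) (auto simp: ordered_prod_def)

lemma (in group_hom) hom_ordered_prod:
  "set gs \<subseteq> carrier G \<Longrightarrow> h (ordered_prod G gs) = ordered_prod H (map h gs)"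
proof (induction gs)
  case (Cons g gs)
  thus ?case using G.ordered_prod_closed[of gs] by (simp add: ordered_prod_def)
qed (simp add: ordered_prod_def)

lemma (in group_hom) symmetric_paths_subset_kernel:
  "symmetric_paths G h E \<subseteq> kernel G H h"
proof
  fix g assume "g \<in> symmetric_paths G h E"
  then obtain ga gb where g: "g = ga \<otimes> inv gb" and pair: "symmetric_pair G h E ga gb"
    by (auto simp: symmetric_paths_def)
  from pair obtain n a b and \<delta> :: "nat \<Rightarrow> int"
    where letters: "\<forall>i<n. (a i, b i) \<in> (E \<times> E) \<inter> kernel_pair (carrier G) h \<and> \<delta> i \<in> {-1, 1}"
      and ga: "ga = ordered_prod G (map (\<lambda>i. a i [^] \<delta> i) [0..<n])"
      and gb: "gb = ordered_prod G (map (\<lambda>i. b i [^] \<delta> i) [0..<n])"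
    unfolding symmetric_pair_def by (elim exE conjE) rule
  have ab: "a i \<in> carrier G" "b i \<in> carrier G" "h (a i) = h (b i)" if "i < n" for i
    using letters that by (auto simp: kernel_pair_def)
  have cl: "set (map (\<lambda>i. a i [^] \<delta> i) [0..<n]) \<subseteq> carrier G"
    "set (map (\<lambda>i. b i [^] \<delta> i) [0..<n]) \<subseteq> carrier G"
    using ab by auto
  have "h (a i [^] \<delta> i) = h (b i [^] \<delta> i)" if "i < n" for i
    using ab[OF that] by (simp only: hom_int_pow)
  hence "map h (map (\<lambda>i. a i [^] \<delta> i) [0..<n]) = map h (map (\<lambda>i. b i [^] \<delta> i) [0..<n])"
    by simp
  hence "h ga = h gb"
    using hom_ordered_prod[OF cl(1)] hom_ordered_prod[OF cl(2)] by (simp only: ga gb)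
  thus "g \<in> kernel G H h"
    using G.ordered_prod_closed[OF cl(1)] G.ordered_prod_closed[OF cl(2)]
    by (simp add: g kernel_def flip: ga gb)
qed


section \<open>Coverings\<close>

text \<open>Taking \<open>x \<triangleleft>\<inverse> a\<close> for \<open>x\<close> in the covering condition gives its counterpart for the inverse operation.\<close>

lemma covering_fibre_acts_alike:
  assumes "rack A" "rack_covering A B f" "x \<in> carrier A" "a \<in> carrier A" "b \<in> carrier A" "f a = f b"
  shows "x \<triangleleft>\<^bsub>A\<^esub> a = x \<triangleleft>\<^bsub>A\<^esub> b" and "x \<triangleleft>\<inverse>\<^bsub>A\<^esub> a = x \<triangleleft>\<inverse>\<^bsub>A\<^esub> b"
proof -
  interpret rack A by fact
  have cov: "(z \<triangleleft>\<^bsub>A\<^esub> a) \<triangleleft>\<inverse>\<^bsub>A\<^esub> b = z" if "z \<in> carrier A" for z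
    using assms that by (auto simp: rack_covering_def kernel_pair_def)
  show "x \<triangleleft>\<^bsub>A\<^esub> a = x \<triangleleft>\<^bsub>A\<^esub> b"
    using cov[of x] inv_op[of "x \<triangleleft>\<^bsub>A\<^esub> a" b] assms(3-5) by (simp add: op_closed)
  show "x \<triangleleft>\<inverse>\<^bsub>A\<^esub> a = x \<triangleleft>\<inverse>\<^bsub>A\<^esub> b"
    using cov[of "x \<triangleleft>\<inverse>\<^bsub>A\<^esub> a"] assms(3-5) by (simp add: inv_op inv_closed)
qed

lemma covering_word_act_alike:
  assumes "rack A" "rack_covering A B f" "x \<in> carrier A"
    and "u \<in> words (carrier A)" "v \<in> words (carrier A)" "relabel f u = relabel f v"
  shows "word_act A x u = word_act A x v"
  using assms(3-)
proof (induction u arbitrary: x v)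
  case (Cons p u)
  interpret rack A by fact
  obtain a e where p: "p = (a, e)" by force
  with Cons.prems(4) obtain b w where v: "v = (b, e) # w" "f a = f b" "relabel f u = relabel f w"
    by (cases v) auto
  have ab: "a \<in> carrier A" "b \<in> carrier A" and w: "u \<in> words (carrier A)" "w \<in> words (carrier A)"
    using Cons.prems(2,3) p v(1) by auto
  note alike = covering_fibre_acts_alike[OF assms(1,2) Cons.prems(1) ab v(2)]
  show ?case
    using Cons.IH[OF _ w v(3)] Cons.prems(1) ab by (simp add: p v(1) alike op_closed inv_closed)
qed simp

text \<open>For a covering \<open>f\<close> with a set-theoretic section \<open>\<sigma>\<close>, letting \<open>b\<close> act on \<open>A\<close> as \<open>\<sigma> b\<close> defines an
  action of \<open>Pth B\<close>. Although \<open>\<sigma>\<close> need not be a morphism, \<open>\<sigma> (y \<triangleleft> b)\<close> and \<open>\<sigma> y \<triangleleft> \<sigma> b\<close> lie in the same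
  fibre and therefore act alike.\<close>

lemma word_act_lift_cong:
  assumes "rack A" "rack B" "rack_covering A B f"
    and \<sigma>: "\<And>b. b \<in> carrier B \<Longrightarrow> \<sigma> b \<in> carrier A \<and> f (\<sigma> b) = b"
    and uv: "(u, v) \<in> word_cong (carrier B) (Pth_rels B)" and x: "x \<in> carrier A"
  shows "word_act A x (relabel \<sigma> u) = word_act A x (relabel \<sigma> v)"
  using uv x
proof (induction arbitrary: x rule: word_cong.induct)
  case (relation u v)
  interpret A: rack A by fact
  interpret B: rack B by fact
  from relation obtain y b where yb: "y \<in> carrier B" "b \<in> carrier B"
    and u: "u = [(y \<triangleleft>\<^bsub>B\<^esub> b, True)]" and v: "v = [(b, False), (y, True), (b, True)]"
    by (auto simp: Pth_rels_def)
  have f: "f \<in> rack_hom A B" using assms(3) by (simp add: rack_covering_def)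
  note \<sigma>' = \<sigma>[OF yb(1)] \<sigma>[OF yb(2)] \<sigma>[OF B.op_closed[OF yb]]
  have "x \<triangleleft>\<^bsub>A\<^esub> \<sigma> (y \<triangleleft>\<^bsub>B\<^esub> b) = x \<triangleleft>\<^bsub>A\<^esub> (\<sigma> y \<triangleleft>\<^bsub>A\<^esub> \<sigma> b)"
    using \<sigma>' relation.prems
    by (intro covering_fibre_acts_alike[OF assms(1,3)]) (simp_all add: A.op_closed rack_homD(2)[OF f])
  also have "\<dots> = ((x \<triangleleft>\<inverse>\<^bsub>A\<^esub> \<sigma> b) \<triangleleft>\<^bsub>A\<^esub> \<sigma> y) \<triangleleft>\<^bsub>A\<^esub> \<sigma> b"
    using \<sigma>' relation.prems A.self_distrib[of "x \<triangleleft>\<inverse>\<^bsub>A\<^esub> \<sigma> b" "\<sigma> y" "\<sigma> b"]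
    by (simp add: A.inv_closed A.inv_op)
  finally show ?case by (simp add: u v)
next
  case (cancel y e)
  thus ?case using \<sigma> assms(1) by (cases e) (auto simp: rack.op_inv rack.inv_op)
next
  case (append u u' v v')
  interpret A: rack A by fact
  have "\<sigma> \<in> carrier B \<rightarrow> carrier A" using \<sigma> by simp
  hence "relabel \<sigma> u' \<in> words (carrier A)"
    using relabel_words word_cong_words[OF append.hyps(1)] by blast
  thus ?case using append by (simp add: A.word_act_append A.word_act_closed)
qed auto

text \<open>Replacing each letter \<open>a\<close> of a word by \<open>\<sigma> (f a)\<close>, in the same fibre, does not change its action.
  So a word acts as its image in \<open>Pth B\<close> does through \<open>\<sigma>\<close>, and trivially if that image is \<open>1\<close>.\<close>

lemma covering_kernel_acts_trivially:
  assumes "rack A" "rack B" and cov: "rack_covering A B f"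
  shows "acts_trivially A (kernel (Pth A) (Pth B) (Pth_map B f))"
  unfolding acts_trivially_def
proof (intro ballI)
  fix x g assume x: "x \<in> carrier A" and g: "g \<in> kernel (Pth A) (Pth B) (Pth_map B f)"
  interpret rack A by fact
  have f: "f \<in> rack_hom A B" "f ` carrier A = carrier B"
    using cov by (auto simp: rack_covering_def)
  from f(1) have fA: "f \<in> carrier A \<rightarrow> carrier B" by (simp add: rack_hom_def)
  from g obtain u where u: "u \<in> words (carrier A)" "g = path_of A u"
    and "Pth_map B f g = \<one>\<^bsub>Pth B\<^esub>"
    by (auto simp: kernel_def elim: Pth_carrierE)
  hence "path_of B (relabel f u) = path_of B []" by (simp add: Pth_map_path_of[OF f(1)] one_Pth)
  hence ker: "(relabel f u, []) \<in> word_cong (carrier B) (Pth_rels B)"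
    using relabel_words[OF u(1) fA] by (subst (asm) eq_equiv_class_iff[OF equiv_word_cong]) simp_all
  define \<sigma> where "\<sigma> = inv_into (carrier A) f"
  have \<sigma>: "\<sigma> b \<in> carrier A \<and> f (\<sigma> b) = b" if "b \<in> carrier B" for b
    using that f(2) by (simp add: \<sigma>_def inv_into_into f_inv_into_f)
  have lift: "relabel \<sigma> w \<in> words (carrier A) \<and> relabel f (relabel \<sigma> w) = w"
    if "w \<in> words (carrier B)" for w
    using that \<sigma> by (induction w) auto
  have "word_act A x u = word_act A x (relabel \<sigma> (relabel f u))"
    using lift[OF relabel_words[OF u(1) fA]] u(1) x
    by (intro covering_word_act_alike[OF assms(1) cov]) simp_all
  also have "\<dots> = x"
    using word_act_lift_cong[OF assms(1,2) cov \<sigma> ker x] by simp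
  finally show "path_act A x g = x" using u x by (simp add: path_act_class)
qed

text \<open>Symmetric paths of length one suffice: the quotient of the generators of \<open>a\<close> and \<open>b\<close> acts as
  \<open>x \<mapsto> (x \<triangleleft> a) \<triangleleft>\<inverse> b\<close>.\<close>

lemma symmetric_paths_act_trivially_covering:
  assumes "rack A" and f: "f \<in> rack_hom A B" "f ` carrier A = carrier B"
    and triv: "acts_trivially A (symmetric_paths (Pth A) (Pth_map B f) (Pth_gen A ` carrier A))"
  shows "rack_covering A B f"
proof -
  interpret rack A by fact
  interpret P: group "Pth A" by (rule group_Pth)
  have "(x \<triangleleft>\<^bsub>A\<^esub> a) \<triangleleft>\<inverse>\<^bsub>A\<^esub> b = x"
    if "x \<in> carrier A" "a \<in> carrier A" "b \<in> carrier A" "f a = f b" for x a b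
  proof -
    note gen = Pth_gen_closed[OF that(2)] Pth_gen_closed[OF that(3)]
    have "Pth_map B f (Pth_gen A a) = Pth_map B f (Pth_gen A b)"
      using that by (simp add: Pth_gen_def Pth_map_path_of[OF f(1)])
    hence "symmetric_pair (Pth A) (Pth_map B f) (Pth_gen A ` carrier A) (Pth_gen A a) (Pth_gen A b)"
      unfolding symmetric_pair_def using gen that
      by (intro exI[of _ 1] exI[of _ "\<lambda>_. Pth_gen A a"] exI[of _ "\<lambda>_. Pth_gen A b"]
          exI[of _ "\<lambda>_. 1"]) (simp add: kernel_pair_def ordered_prod_def P.int_pow_1)
    hence "Pth_gen A a \<otimes>\<^bsub>Pth A\<^esub> inv\<^bsub>Pth A\<^esub> Pth_gen A b \<in>
        symmetric_paths (Pth A) (Pth_map B f) (Pth_gen A ` carrier A)"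
      unfolding symmetric_paths_def by blast
    moreover have "Pth_gen A a \<otimes>\<^bsub>Pth A\<^esub> inv\<^bsub>Pth A\<^esub> Pth_gen A b = path_of A [(a, True), (b, False)]"
      using that by (simp add: inv_Pth_gen) (simp add: Pth_gen_def path_of_append)
    ultimately have "path_act A x (path_of A [(a, True), (b, False)]) = x"
      using triv that(1) by (simp add: acts_trivially_def)
    thus ?thesis using that by (simp add: path_act_class)
  qed
  thus ?thesis using f by (auto simp: rack_covering_def kernel_pair_def)
qed

theorem theorem3p1p1p1:
  fixes A :: "'a rack" and B :: "'b rack" and f :: "'a \<Rightarrow> 'b"
  assumes "rack A \<and> rack B \<or> quandle A \<and> quandle B"
    and "f \<in> rack_hom A B"
    and "f ` carrier A = carrier B"
  shows "(rack_covering A B f \<longleftrightarrow>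
            acts_trivially A (symmetric_paths (Pth A) (Pth_map B f) (Pth_gen A ` carrier A))) \<and>
         (rack_covering A B f \<longleftrightarrow>
            acts_trivially A (kernel (Pth A) (Pth B) (Pth_map B f))) \<and>
         (rack_covering A B f \<longleftrightarrow>
            subgroup (kernel (Pth A) (Pth B) (Pth_map B f))
              (Pth A\<lparr>carrier := kernel (Pth A) (rack_Inn A) (Pth_to_Inn A)\<rparr>))"
proof -
  let ?Sym = "symmetric_paths (Pth A) (Pth_map B f) (Pth_gen A ` carrier A)"
  let ?Ker = "kernel (Pth A) (Pth B) (Pth_map B f)"
  have A: "rack A" and B: "rack B" using assms(1) quandle.axioms(1) by blast+
  interpret f: group_hom "Pth A" "Pth B" "Pth_map B f"
    using group_Pth group_Pth Pth_map_hom[OF B assms(2)]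
    by (intro group_hom.intro group_hom_axioms.intro)
  have "acts_trivially A ?Ker \<Longrightarrow> acts_trivially A ?Sym"
    using f.symmetric_paths_subset_kernel by (auto simp: acts_trivially_def)
  thus ?thesis
    using covering_kernel_acts_trivially[OF A B]
      symmetric_paths_act_trivially_covering[OF A assms(2,3)]
      acts_trivially_iff_subgroup_kernel[OF A f.subgroup_kernel] by blast
qed

end
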